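(* Consider the semi-explicit nonlinear descriptor (differential-algebraic) system $$\dot{\mathbf{x}}_d=\mathbf{f}(\mathbf{x}_d,\mathbf{x}_a,\mathbf{u}),\qquad \mathbf{0}=\mathbf{g}(\mathbf{x}_d,\mathbf{x}_a), \tag{DAE}$$ and suppose that Assumption (S), stated in the context, holds true for any initial condition and control input. Then (DAE) can be restructured into a nonlinear ODE system by applying the implicit function theorem to resolve the algebraic constraints $\mathbf{0}=\mathbf{g}(\mathbf{x}_d,\mathbf{x}_a)$ into ODEs. As such, (DAE) can be rewritten as $$\dot{\mathbf{x}}_d=\mathbf{f}(\mathbf{x}_d,\mathbf{x}_a,\mathbf{u}),\qquad \dot{\mathbf{x}}_a=-\big(\mathbf{G}_{\mathbf{x}_a}\big)^{-1}\mathbf{G}_{\mathbf{x}_d}\,\mathbf{f}(\mathbf{x}_d,\mathbf{x}_a,\mathbf{u})=\tilde{\mathbf{g}}(\mathbf{x}_d,\mathbf{x}_a,\mathbf{u}),$$ where $\mathbf{G}_{\mathbf{x}_a}:=\frac{\partial\mathbf{g}(\mathbf{x}_d,\mathbf{x}_a)}{\partial\mathbf{x}_a}\in\mathbb{R}^{n_a\times n_a}$ and $\mathbf{G}_{\mathbf{x}_d}:=\frac{\partial\mathbf{g}(\mathbf{x}_d,\mathbf{x}_a)}{\partial\mathbf{x}_d}\in\mathbb{R}^{n_a\times n_d}$ are the Jacobian matrices of the algebraic constraints, and the last equality defines $\tilde{\mathbf{g}}$.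
   Context: The system is a model of a multi-machine power system. Here $\mathbf{x}_d=\mathbf{x}_d(t)\in\mathbb{R}^{n_d}$ are the dynamic (generator) states, $\mathbf{x}_a=\mathbf{x}_a(t)\in\mathbb{R}^{n_a}$ the algebraic states, and $\mathbf{u}=\mathbf{u}(t)\in\mathbb{R}^{n_u}$ the input. The functions $\mathbf{f}:\mathbb{R}^{n_d}\times\mathbb{R}^{n_a}\times\mathbb{R}^{n_u}\to\mathbb{R}^{n_d}$ and $\mathbf{g}:\mathbb{R}^{n_d}\times\mathbb{R}^{n_a}\to\mathbb{R}^{n_a}$ are nonlinear and define the generator dynamics and the power flows (algebraic constraints), respectively. Assumption (S): the system (DAE) is strangeness-free, of differentiation index one, and regular. Thus, under any consistent initial conditions a unique solution exists, and the partial derivatives of $\mathbf{f}$ and $\mathbf{g}$ with respect to $\mathbf{x}_d$ and $\mathbf{x}_a$ are non-singular (in particular, $\frac{\partial\mathbf{g}}{\partial\mathbf{x}_a}$ is non-singular). Terminology: strangeness-free means that the strangeness index (a generalization, for nonlinear DAEs, of the differentiation index) equals zero. The differentiation index of a descriptor system is the number of differentiations required to obtain ODEs using algebraic manipulations. Regularity refers to the linearization of (DAE) around an initial state, written $\mathbf{E}\dot{\mathbf{x}}=\mathbf{A}\mathbf{x}+\mathbf{B}\mathbf{u}$ with $\mathbf{x}=(\mathbf{x}_d,\mathbf{x}_a)$, constant matrices $\mathbf{A},\mathbf{B}$, and $\mathbf{E}$ the singular diagonal mass matrix with ones for the differential equations and zeros for the algebraic equations: it is regular if and only if $\det(s\mathbf{E}-\mathbf{A})\neq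 0$ for $s\in\mathbb{C}$. *)

theory Defs
  imports "HOL-Analysis.Analysis"
begin

definition continuously_differentiable ::
    "('a::real_normed_vector \<Rightarrow> 'b::real_normed_vector) \<Rightarrow> bool" where
  "continuously_differentiable h \<longleftrightarrow>
     (\<exists>h' :: 'a \<Rightarrow> ('a \<Rightarrow>\<^sub>L 'b). (\<forall>x. (h has_derivative blinfun_apply (h' x)) (at x))
        \<and> continuous_on UNIV h')"

definition Jacobian :: "(real^'n \<Rightarrow> real^'m) \<Rightarrow> real^'n \<Rightarrow> real^'n^'m" where
  "Jacobian h x = matrix (frechet_derivative h (at x))"

text \<open>
  In an implicit system \<open>F(t, x, x') = 0\<close> an input signal is understood to be already inserted
  in \<open>F\<close>, which is then a function of time, state and velocity.

  The differentiation index is defined through derivative arrays (Campbell and Gear; Brenan,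
  Campbell and Petzold). A sequence \<open>X\<close> lists candidate values of the derivatives
  \<open>X 0 = x\<close>, \<open>X 1 = x'\<close>, \<open>X 2 = x''\<close>, ... of a solution at time \<open>t\<close>. The array of order \<open>k\<close>
  consists of the equations obtained from \<open>F(t, x, x') = 0\<close> by at most \<open>k\<close> total
  differentiations in time. The \<open>j\<close>-th total derivative is computed along the polynomial curve with
  the Taylor coefficients prescribed by \<open>X\<close>; for \<open>F\<close> of class \<open>C\<^sup>k\<close> and \<open>j \<le> k\<close> its value at \<open>t\<close>
  depends only on \<open>X 0\<close>, ..., \<open>X (j + 1)\<close>.
\<close>

definition taylor_curve :: "nat \<Rightarrow> real \<Rightarrow> (nat \<Rightarrow> 'a::real_vector) \<Rightarrow> real \<Rightarrow> 'a" where
  "taylor_curve m t X s = (\<Sum>i\<le>m. ((s - t) ^ i / fact i) *\<^sub>R X i)"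

definition derivative_array ::
    "(real \<Rightarrow> real^'n \<Rightarrow> real^'n \<Rightarrow> real^'n) \<Rightarrow> nat \<Rightarrow> real \<Rightarrow> (nat \<Rightarrow> real^'n) \<Rightarrow> bool" where
  "derivative_array F k t X \<longleftrightarrow>
     (\<forall>j\<le>k. ((\<lambda>h s. vector_derivative h (at s)) ^^ j)
               (\<lambda>s. F s (taylor_curve (k + 1) t X s) (taylor_curve k t (\<lambda>i. X (Suc i)) s)) t = 0)"

text \<open>
  Differentiating \<open>k\<close> times yields an ODE if the array of order \<open>k\<close> determines \<open>x'\<close> as a
  continuous function of \<open>(t, x)\<close>.
\<close>

definition array_determines_ode ::
    "(real \<Rightarrow> real^'n \<Rightarrow> real^'n \<Rightarrow> real^'n) \<Rightarrow> nat \<Rightarrow> bool" where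
  "array_determines_ode F k \<longleftrightarrow>
     (\<exists>\<phi> :: real \<times> (real^'n) \<Rightarrow> real^'n.
        continuous_on {(t, X 0) |t X. derivative_array F k t X} \<phi> \<and>
        (\<forall>t X. derivative_array F k t X \<longrightarrow> X 1 = \<phi> (t, X 0)))"

definition has_differentiation_index ::
    "(real \<Rightarrow> real^'n \<Rightarrow> real^'n \<Rightarrow> real^'n) \<Rightarrow> nat \<Rightarrow> bool" where
  "has_differentiation_index F \<nu> \<longleftrightarrow>
     array_determines_ode F \<nu> \<and> (\<forall>k<\<nu>. \<not> array_determines_ode F k)"

text \<open>
  Strangeness index zero is the case \<open>\<mu> = 0\<close> of the hypothesis of Kunkel and Mehrmann. With
  \<open>E = \<partial>F/\<partial>x'\<close> and \<open>N = \<partial>F/\<partial>x\<close>, it asks for integers \<open>a\<close> and \<open>d = n - a\<close> such that, at every point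
  of the nonempty zero set of \<open>F\<close>: \<open>rank E = n - a\<close>; for \<open>Z\<close> with columns spanning the kernel of
  \<open>E\<^sup>T\<close>, \<open>rank (Z\<^sup>T N) = a\<close>; for \<open>T\<close> with columns spanning the kernel of \<open>Z\<^sup>T N\<close>, \<open>rank (E T) = d\<close>.
  The column numbers of \<open>Z\<close> and \<open>T\<close> are not types, so these ranks are written as dimensions of
  subspaces: the range of \<open>(Z\<^sup>T N)\<^sup>T = N\<^sup>T Z\<close> is the image of the kernel of \<open>E\<^sup>T\<close> under \<open>N\<^sup>T\<close>, and
  the range of \<open>E T\<close> is the image under \<open>E\<close> of the kernel of \<open>Z\<^sup>T N\<close>.
\<close>

definition strangeness_free :: "(real \<Rightarrow> real^'n \<Rightarrow> real^'n \<Rightarrow> real^'n) \<Rightarrow> bool" where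
  "strangeness_free F \<longleftrightarrow>
     (\<exists>t x v. F t x v = 0) \<and>
     (\<exists>a d :: nat. a + d = CARD('n) \<and>
       (\<forall>t x v. F t x v = 0 \<longrightarrow>
         (let E = Jacobian (\<lambda>w. F t x w) v;
              N = Jacobian (\<lambda>y. F t y v) x;
              coker = {z. transpose E *v z = 0};
              ker_ZN = {y. \<forall>z\<in>coker. z \<bullet> (N *v y) = 0}
          in rank E = d \<and>
             dim ((\<lambda>z. transpose N *v z) ` coker) = a \<and>
             dim ((\<lambda>y. E *v y) ` ker_ZN) = d)))"

text \<open>
  Regularity means that \<open>det (s E - A)\<close> is not the zero polynomial in \<open>s\<close>, so \<open>s\<close> is
  existentially quantified.
\<close>

definition regular_pencil :: "real^'n^'n \<Rightarrow> real^'n^'n \<Rightarrow> bool" where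
  "regular_pencil E A \<longleftrightarrow>
     (\<exists>s::complex. det ((\<chi> i j. s * of_real (E $ i $ j) - of_real (A $ i $ j)) :: complex^'n^'n) \<noteq> 0)"

definition stack :: "real^'nd \<Rightarrow> real^'na \<Rightarrow> real^('nd::finite + 'na::finite)" where
  "stack xd xa = (\<chi> i. case i of Inl k \<Rightarrow> xd $ k | Inr k \<Rightarrow> xa $ k)"

definition dyn_part :: "real^('nd::finite + 'na::finite) \<Rightarrow> real^'nd" where
  "dyn_part x = (\<chi> k. x $ Inl k)"

definition alg_part :: "real^('nd::finite + 'na::finite) \<Rightarrow> real^'na" where
  "alg_part x = (\<chi> k. x $ Inr k)"

definition mass_matrix :: "real^('nd::finite + 'na::finite)^('nd::finite + 'na::finite)" where
  "mass_matrix = (\<chi> i j. if i = j then (case i of Inl _ \<Rightarrow> 1 | Inr _ \<Rightarrow> 0) else 0)"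

definition dae_rhs ::
    "((real^'nd) \<times> (real^'na) \<times> (real^'nu) \<Rightarrow> real^'nd) \<Rightarrow> ((real^'nd) \<times> (real^'na) \<Rightarrow> real^'na)
      \<Rightarrow> real^('nd::finite + 'na::finite) \<Rightarrow> real^'nu \<Rightarrow> real^('nd::finite + 'na::finite)" where
  "dae_rhs f g x w =
     stack (f (dyn_part x, alg_part x, w)) (g (dyn_part x, alg_part x))"

definition dae_residual ::
    "((real^'nd) \<times> (real^'na) \<times> (real^'nu) \<Rightarrow> real^'nd) \<Rightarrow> ((real^'nd) \<times> (real^'na) \<Rightarrow> real^'na)
      \<Rightarrow> (real \<Rightarrow> real^'nu)
      \<Rightarrow> real \<Rightarrow> real^('nd::finite + 'na::finite) \<Rightarrow> real^('nd::finite + 'na::finite) \<Rightarrow> real^('nd::finite + 'na::finite)" where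
  "dae_residual f g u t x v = mass_matrix *v v - dae_rhs f g x (u t)"

text \<open>
  The derivative array of order one contains the time derivative of the input, so the index
  assumptions are imposed for continuously differentiable inputs. An initial state is
  consistent if it satisfies the algebraic constraints.
\<close>

definition assumption_S ::
    "((real^'nd) \<times> (real^'na) \<times> (real^'nu) \<Rightarrow> real^'nd) \<Rightarrow> ((real^'nd) \<times> (real^'na) \<Rightarrow> real^'na) \<Rightarrow> bool" where
  "assumption_S f g \<longleftrightarrow>
     (\<forall>u. continuously_differentiable u \<longrightarrow>
        strangeness_free (dae_residual f g u) \<and>
        has_differentiation_index (dae_residual f g u) 1 \<and>
        (\<forall>t xd xa. g (xd, xa) = 0 \<longrightarrow>
           regular_pencil mass_matrix (Jacobian (\<lambda>x. dae_rhs f g x (u t)) (stack xd xa))))"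

definition G_xd :: "((real^'nd) \<times> (real^'na) \<Rightarrow> real^'na) \<Rightarrow> real^'nd \<Rightarrow> real^'na \<Rightarrow> real^'nd^'na" where
  "G_xd g xd xa = Jacobian (\<lambda>y. g (y, xa)) xd"

definition G_xa :: "((real^'nd) \<times> (real^'na) \<Rightarrow> real^'na) \<Rightarrow> real^'nd \<Rightarrow> real^'na \<Rightarrow> real^'na^'na" where
  "G_xa g xd xa = Jacobian (\<lambda>y. g (xd, y)) xa"

definition g_tilde ::
    "((real^'nd) \<times> (real^'na) \<times> (real^'nu) \<Rightarrow> real^'nd) \<Rightarrow> ((real^'nd) \<times> (real^'na) \<Rightarrow> real^'na)
      \<Rightarrow> (real^'nd) \<times> (real^'na) \<times> (real^'nu) \<Rightarrow> real^'na" where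
  "g_tilde f g = (\<lambda>(xd, xa, w).
     - (matrix_inv (G_xa g xd xa) *v (G_xd g xd xa *v f (xd, xa, w))))"

text \<open>
  A solution of the DAE on an interval \<open>J\<close> has a differentiable dynamic part, whereas its
  algebraic part, whose derivative does not occur in the equations, is only required to be
  continuous. Derivatives at endpoints of \<open>J\<close> are one-sided.
\<close>

definition dae_solution ::
    "((real^'nd) \<times> (real^'na) \<times> (real^'nu) \<Rightarrow> real^'nd) \<Rightarrow> ((real^'nd) \<times> (real^'na) \<Rightarrow> real^'na)
      \<Rightarrow> (real \<Rightarrow> real^'nu) \<Rightarrow> real set \<Rightarrow> (real \<Rightarrow> real^'nd) \<Rightarrow> (real \<Rightarrow> real^'na) \<Rightarrow> bool" where
  "dae_solution f g u J xd xa \<longleftrightarrow>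
     continuous_on J xa \<and>
     (\<forall>t\<in>J. (xd has_vector_derivative f (xd t, xa t, u t)) (at t within J)
           \<and> 0 = g (xd t, xa t))"

definition ode_solution ::
    "((real^'nd) \<times> (real^'na) \<times> (real^'nu) \<Rightarrow> real^'nd) \<Rightarrow> ((real^'nd) \<times> (real^'na) \<times> (real^'nu) \<Rightarrow> real^'na)
      \<Rightarrow> (real \<Rightarrow> real^'nu) \<Rightarrow> real set \<Rightarrow> (real \<Rightarrow> real^'nd) \<Rightarrow> (real \<Rightarrow> real^'na) \<Rightarrow> bool" where
  "ode_solution f h u J xd xa \<longleftrightarrow>
     (\<forall>t\<in>J. (xd has_vector_derivative f (xd t, xa t, u t)) (at t within J)
           \<and> (xa has_vector_derivative h (xd t, xa t, u t)) (at t within J))"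

end

theory Submission
  imports Defs
begin

text \<open>
  With \<open>E = diag(I, 0)\<close>, strangeness index zero says that \<open>E\<close> is injective on the kernel of
  \<open>[G_xd G_xa]\<close>. A vector \<open>(0, k)\<close> with \<open>G_xa k = 0\<close> lies in that kernel and is annihilated by \<open>E\<close>, so
  \<open>G_xa\<close> is invertible on the constraint set. The implicit function then comes from inverting
  \<open>(x, y) \<mapsto> (x, g (x, y))\<close>; along a solution \<open>xa = \<phi> \<circ> xd\<close> locally, which makes the merely
  continuous algebraic part differentiable.
\<close>

section \<open>Linear algebra\<close>

text \<open>The images of a basis of \<open>S\<close> span the image of \<open>S\<close>. As the
  image has the same dimension as \<open>S\<close>, they are distinct and independent, and a linear
  map taking a basis injectively to an independent set is injective on the span.\<close>

lemma linear_inj_on_dim_image: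
  fixes f :: "'a::euclidean_space \<Rightarrow> 'b::euclidean_space"
  assumes f: "linear f" and S: "subspace S" and dim: "dim (f ` S) = dim S"
  shows "inj_on f S"
proof -
  obtain B where B: "B \<subseteq> S" "independent B" "S \<subseteq> span B" "card B = dim S"
    using basis_exists by blast
  have finB: "finite B" using B(2) independent_bound by blast
  have span: "f ` S = span (f ` B)"
    by (metis B(1,3) S f linear_span_image span_minimal subset_antisym)
  have "dim (f ` S) \<le> card (f ` B)"
    using span finB by (simp add: dim_le_card')
  then have card: "card (f ` B) = card B"
    using dim B(4) card_image_le[OF finB, of f] by simp
  then have inj: "inj_on f B" using finB eq_card_imp_inj_on by blast
  have "independent (f ` B)"
    using span card dim B(4) finB card_le_dim_spanning[of "f ` B" "f ` S"]
    by (simp add: span_superset)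
  then have "inj_on f (span B)"
    using f inj linear_inj_on_span_independent_image by blast
  then show ?thesis using B(3) inj_on_subset by blast
qed

text \<open>Moving \<open>A\<close> across the inner product exhibits the first set as the
  orthogonal complement of the image of \<open>S\<close> under the transpose. With the kernel of
  \<open>E\<^sup>T\<close> for \<open>S\<close>, this converts the rank of
  \<open>Z\<^sup>T N\<close> into the dimension of its kernel.\<close>

lemma dim_kernel_matrix:
  fixes A :: "real^'n^'m"
  assumes "subspace S"
  shows "dim {x. \<forall>z\<in>S. z \<bullet> (A *v x) = 0} + dim ((\<lambda>z. transpose A *v z) ` S) = CARD('n)"
proof -
  have "x \<bullet> (transpose A *v z) = z \<bullet> (A *v x)" for x z
    by (simp add: inner_commute[of x] dot_lmul_matrix)
  then have "{x. \<forall>z\<in>S. z \<bullet> (A *v x) = 0} =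
      {y \<in> UNIV. \<forall>x \<in> (\<lambda>z. transpose A *v z) ` S. orthogonal x y}"
    by (auto simp: orthogonal_def inner_commute simp del: transpose_matrix_vector)
  moreover have "dim {y \<in> UNIV. \<forall>x \<in> (\<lambda>z. transpose A *v z) ` S. orthogonal x y}
      + dim ((\<lambda>z. transpose A *v z) ` S) = dim (UNIV :: (real^'n) set)"
    using assms by (intro dim_subspace_orthogonal_to_vectors linear_subspace_image)
      (auto simp del: transpose_matrix_vector)
  ultimately show ?thesis by simp
qed

lemma invertible_iff_ker:
  fixes A :: "real^'n^'n"
  shows "invertible A \<longleftrightarrow> (\<forall>x. A *v x = 0 \<longrightarrow> x = 0)"
  by (simp add: invertible_left_inverse matrix_left_invertible_ker)

lemma matrix_inv_mult_vector:
  fixes A :: "real^'n^'n"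
  assumes "invertible A"
  shows "matrix_inv A *v (A *v x) = x" "A *v (matrix_inv A *v x) = x"
proof -
  have "A ** matrix_inv A = mat 1 \<and> matrix_inv A ** A = mat 1"
    using assms unfolding invertible_def matrix_inv_def by (rule someI_ex)
  then show "matrix_inv A *v (A *v x) = x" "A *v (matrix_inv A *v x) = x"
    by (simp_all add: matrix_vector_mul_assoc)
qed

section \<open>Implicit functions\<close>

text \<open>The function \<open>\<phi>\<close> is the second component of a local inverse of
  \<open>H\<close> along the points \<open>(x, 0)\<close>. The equivalence on a box lets a
  continuous curve in the zero set be recognised as lying on the graph of \<open>\<phi>\<close>, and
  the last conclusion is implicit differentiation.\<close>

lemma implicit_function:
  fixes g :: "'a::euclidean_space \<times> 'b::euclidean_space \<Rightarrow> 'b"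
    and g' :: "'a \<times> 'b \<Rightarrow> ('a \<times> 'b) \<Rightarrow>\<^sub>L 'b"
  assumes der: "\<And>p. (g has_derivative blinfun_apply (g' p)) (at p)"
    and cont: "continuous_on UNIV g'"
    and zero: "g (x0, y0) = 0"
    and ker: "\<And>k. g' (x0, y0) (0, k) = 0 \<Longrightarrow> k = 0"
  obtains U V \<phi> \<phi>' where "open U" "open V" "x0 \<in> U" "y0 \<in> V" "\<phi> ` U \<subseteq> V"
    "\<forall>x\<in>U. \<forall>y\<in>V. g (x, y) = 0 \<longleftrightarrow> y = \<phi> x"
    "\<forall>x\<in>U. (\<phi> has_derivative \<phi>' x) (at x)"
    "\<forall>x\<in>U. \<forall>h. g' (x, \<phi> x) (h, \<phi>' x h) = 0"
proof -
  define H where "H = (\<lambda>p. (fst p, g p))"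
  define H' where "H' = (\<lambda>p. Blinfun (\<lambda>h. (fst h, g' p h)))"
  have H'_apply: "blinfun_apply (H' p) = (\<lambda>h. (fst h, g' p h))" for p
    unfolding H'_def
    by (rule bounded_linear_Blinfun_apply)
      (intro bounded_linear_Pair bounded_linear_fst blinfun.bounded_linear_right)
  have derH: "(H has_derivative blinfun_apply (H' p)) (at p)" for p
    unfolding H_def H'_apply
    by (intro has_derivative_Pair has_derivative_fst has_derivative_ident der)
  have contH: "continuous_on UNIV H'"
    by (rule continuous_on_blinfun_componentwise)
      (auto simp: H'_apply intro!: continuous_intros cont)
  have lin: "linear (blinfun_apply (H' (x0, y0)))"
    by (simp add: blinfun.bounded_linear_right bounded_linear.linear)
  \<comment> \<open>A vector \<open>(h, k)\<close> in the kernel has \<open>h = 0\<close> by its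
    first component, and then \<open>ker\<close> gives \<open>k = 0\<close>.\<close>
  have "inj (blinfun_apply (H' (x0, y0)))"
    using lin ker by (auto simp: linear_injective_0 H'_apply zero_prod_def)
  then obtain L where L: "linear L" "L \<circ> blinfun_apply (H' (x0, y0)) = id"
    using linear_injective_left_inverse lin by blast
  have Linv: "Blinfun L o\<^sub>L H' (x0, y0) = id_blinfun"
    using L by (intro blinfun_eqI)
      (simp add: linear_linear bounded_linear_Blinfun_apply pointfree_idE)
  obtain U' W K K' where *: "open U'" "U' \<subseteq> UNIV" "(x0, y0) \<in> U'" "open W" "H (x0, y0) \<in> W"
      "homeomorphism U' W H K" "\<And>q. q \<in> W \<Longrightarrow> (K has_derivative K' q) (at q)"
    using inverse_function_theorem[OF open_UNIV derH contH UNIV_I Linv] by metis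
  \<comment> \<open>The neighbourhood is shrunk to a box so that \<open>x\<close> and
    \<open>y\<close> can be restricted independently.\<close>
  obtain U0 V where "open U0" "open V" "(x0, y0) \<in> U0 \<times> V" "U0 \<times> V \<subseteq> U'"
    by (rule open_prod_elim[OF *(1,3)])
  then have UV: "open U0" "open V" "x0 \<in> U0" "y0 \<in> V" "U0 \<times> V \<subseteq> U'"
    by simp_all
  \<comment> \<open>\<open>S\<close> collects the \<open>x\<close> for which \<open>(x, 0)\<close>
    lies in the domain \<open>W\<close> of the local inverse. In \<open>U\<close>, the factor
    \<open>U0\<close> keeps \<open>(x, y)\<close> inside \<open>U'\<close> for all \<open>y\<close>
    in \<open>V\<close>, and the preimage of \<open>V\<close> keeps the values of
    \<open>\<phi>\<close> in \<open>V\<close>.\<close>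
  define S where "S = (\<lambda>x. (x, 0::'b)) -` W"
  define \<phi> where "\<phi> = (\<lambda>x. snd (K (x, 0)))"
  define \<phi>' where "\<phi>' = (\<lambda>x h. snd (K' (x, 0) (h, 0)))"
  define U where "U = U0 \<inter> (S \<inter> \<phi> -` V)"
  have openS: "open S" unfolding S_def
    by (intro open_vimage *(4) continuous_intros)
  have der\<phi>: "(\<phi> has_derivative \<phi>' x) (at x)" if "x \<in> S" for x
  proof -
    have "((\<lambda>x. (x, 0::'b)) has_derivative (\<lambda>h. (h, 0))) (at x)"
      by (intro has_derivative_Pair has_derivative_ident has_derivative_const)
    moreover have "(K has_derivative K' (x, 0)) (at (x, 0))"
      using that *(7) by (simp add: S_def)
    ultimately have "((\<lambda>x. K (x, 0)) has_derivative (\<lambda>h. K' (x, 0) (h, 0))) (at x)"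
      by (rule has_derivative_compose)
    then show ?thesis unfolding \<phi>_def \<phi>'_def by (rule has_derivative_snd)
  qed
  have "continuous_on S \<phi>"
    using der\<phi> has_derivative_continuous by (blast intro: continuous_at_imp_continuous_on)
  then have openU: "open U" unfolding U_def
    using UV(1,2) openS by (blast intro: open_Int continuous_open_preimage)
  have K0: "K (x, 0) = (x, \<phi> x)" "g (x, \<phi> x) = 0" if "x \<in> S" for x
  proof -
    have "H (K (x, 0)) = (x, 0)"
      using that *(6) by (simp add: S_def homeomorphism_apply2)
    then show "K (x, 0) = (x, \<phi> x)" and "g (x, \<phi> x) = 0"
      unfolding H_def \<phi>_def by (metis prod.collapse prod.inject)+
  qed
  have uniq: "g (x, y) = 0 \<longleftrightarrow> y = \<phi> x" if "x \<in> U" "y \<in> V" for x y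
  proof
    assume "g (x, y) = 0"
    then have "H (x, y) = (x, 0)" by (simp add: H_def)
    moreover have "(x, y) \<in> U'" using that UV(5) by (auto simp: U_def)
    ultimately have "K (x, 0) = (x, y)" using *(6) homeomorphism_apply1 by fastforce
    then show "y = \<phi> x" by (simp add: \<phi>_def)
  qed (use that K0 in \<open>auto simp: U_def\<close>)
  \<comment> \<open>The identity \<open>g (x, \<phi> x) = 0\<close> holds on the open set
    \<open>U\<close>, so the derivative given by the chain rule must coincide with zero.\<close>
  have "g' (x, \<phi> x) (h, \<phi>' x h) = 0" if "x \<in> U" for x h
  proof -
    have "((\<lambda>x. (x, \<phi> x)) has_derivative (\<lambda>h. (h, \<phi>' x h))) (at x)"
      using that by (intro has_derivative_Pair has_derivative_ident der\<phi>) (simp add: U_def)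
    then have "((\<lambda>x. g (x, \<phi> x)) has_derivative (\<lambda>h. g' (x, \<phi> x) (h, \<phi>' x h))) (at x)"
      by (rule has_derivative_compose[OF _ der])
    moreover have "((\<lambda>x. g (x, \<phi> x)) has_derivative (\<lambda>h. 0)) (at x)"
      by (rule has_derivative_transform_within_open[OF _ openU that, of "\<lambda>x. 0"])
        (auto simp: U_def K0)
    ultimately show ?thesis
      by (metis has_derivative_unique)
  qed
  moreover have "x0 \<in> U" "y0 \<in> V"
  proof -
    have "H (x0, y0) = (x0, 0)" by (simp add: H_def zero)
    then have "x0 \<in> S" "K (x0, 0) = (x0, y0)"
      using *(3,5,6) homeomorphism_apply1 by (fastforce simp: S_def)+
    then show "x0 \<in> U" "y0 \<in> V" using UV by (auto simp: U_def \<phi>_def)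
  qed
  moreover have "\<phi> ` U \<subseteq> V" by (auto simp: U_def)
  moreover have "(\<phi> has_derivative \<phi>' x) (at x)" if "x \<in> U" for x
    using that der\<phi> by (simp add: U_def)
  ultimately show thesis
    using openU UV(2) uniq by (intro that[of U V \<phi> \<phi>']) simp_all
qed

section \<open>Jacobians of the constraint\<close>

lemma Jacobian_mult:
  assumes "(h has_derivative h') (at x)"
  shows "Jacobian h x *v y = h' y"
  using assms frechet_derivative_at[OF assms] has_derivative_bounded_linear[OF assms]
  unfolding Jacobian_def by (metis matrix_vector_mul(3))

lemma G_xd_mult:
  assumes "(g has_derivative g') (at (xd, xa))"
  shows "G_xd g xd xa *v h = g' (h, 0)"
proof -
  have "((\<lambda>y. (y, xa)) has_derivative (\<lambda>h. (h, 0))) (at xd)"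
    by (intro has_derivative_Pair has_derivative_ident has_derivative_const)
  from has_derivative_compose[OF this assms] show ?thesis
    unfolding G_xd_def by (rule Jacobian_mult)
qed

lemma G_xa_mult:
  assumes "(g has_derivative g') (at (xd, xa))"
  shows "G_xa g xd xa *v k = g' (0, k)"
proof -
  have "((\<lambda>y. (xd, y)) has_derivative (\<lambda>k. (0, k))) (at xa)"
    by (intro has_derivative_Pair has_derivative_ident has_derivative_const)
  from has_derivative_compose[OF this assms] show ?thesis
    unfolding G_xa_def by (rule Jacobian_mult)
qed

lemma derivative_split:
  assumes "(g has_derivative g') (at (xd, xa))"
  shows "g' (h, k) = G_xd g xd xa *v h + G_xa g xd xa *v k"
proof -
  interpret g': bounded_linear g' using assms by (rule has_derivative_bounded_linear)
  show ?thesis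
    using g'.add[of "(h, 0)" "(0, k)"] by (simp add: G_xd_mult[OF assms] G_xa_mult[OF assms])
qed

text \<open>Splitting \<open>g'\<close> into its two partial Jacobians leaves a linear equation for
  \<open>k\<close>. Read from left to right this yields the derivative of the implicit function;
  from right to left it shows that the velocity prescribed by \<open>g_tilde\<close> is tangent to
  the level sets of \<open>g\<close>.\<close>

lemma derivative_eq_0_iff:
  assumes "(g has_derivative g') (at (xd, xa))" and "invertible (G_xa g xd xa)"
  shows "g' (h, k) = 0 \<longleftrightarrow> k = - (matrix_inv (G_xa g xd xa) *v (G_xd g xd xa *v h))"
proof -
  let ?A = "G_xa g xd xa" and ?b = "G_xd g xd xa *v h"
  have "g' (h, k) = 0 \<longleftrightarrow> ?A *v k = - ?b"
    unfolding derivative_split[OF assms(1)] by (simp add: add_eq_0_iff)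
  also have "\<dots> \<longleftrightarrow> k = matrix_inv ?A *v (- ?b)"
    using matrix_inv_mult_vector[OF assms(2)] by metis
  also have "matrix_inv ?A *v (- ?b) = - (matrix_inv ?A *v ?b)"
    by (simp add: linear_neg)
  finally show ?thesis .
qed

text \<open>Each entry of \<open>G_xa\<close> is a coordinate of \<open>g'\<close> at a vector
  \<open>(0, axis j 1)\<close>, and the determinant is a polynomial in the entries. Hence
  invertibility of \<open>G_xa\<close> persists near a state where it holds, also off the zero set
  of \<open>g\<close>.\<close>

lemma continuous_det_G_xa:
  fixes g :: "(real^'nd) \<times> (real^'na) \<Rightarrow> real^'na"
    and g' :: "(real^'nd) \<times> (real^'na) \<Rightarrow> ((real^'nd) \<times> (real^'na)) \<Rightarrow>\<^sub>L (real^'na)"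
  assumes der: "\<And>p. (g has_derivative blinfun_apply (g' p)) (at p)"
    and cont: "continuous_on UNIV g'"
  shows "continuous_on UNIV (\<lambda>p. det (G_xa g (fst p) (snd p)))"
proof -
  have entry: "G_xa g (fst p) (snd p) $ i $ j = g' p (0, axis j 1) $ i" for p i j
    using arg_cong[OF G_xa_mult[OF der, of "fst p" "snd p" "axis j 1"], of "\<lambda>v. v $ i"]
    by (simp add: matrix_vector_mult_basis column_def)
  show ?thesis unfolding det_def entry
    by (intro continuous_intros cont)
qed

section \<open>The differential-algebraic system\<close>

lemma bounded_linear_dyn_part: "bounded_linear dyn_part"
  unfolding linear_conv_bounded_linear[symmetric] by (rule linearI) (simp_all add: dyn_part_def vec_eq_iff)

lemma bounded_linear_alg_part: "bounded_linear alg_part"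
  unfolding linear_conv_bounded_linear[symmetric] by (rule linearI) (simp_all add: alg_part_def vec_eq_iff)

text \<open>Linearity is expressed on pairs so that the derivative of a stacked map follows from
  that of a pair of maps.\<close>

lemma bounded_linear_stack:
  "bounded_linear (\<lambda>p. stack (fst p :: real^'nd) (snd p :: real^'na))"
  unfolding linear_conv_bounded_linear[symmetric]
  by (rule linearI) (auto simp: stack_def vec_eq_iff split: sum.split)

lemma dyn_part_stack [simp]: "dyn_part (stack xd xa) = xd"
  by (simp add: dyn_part_def stack_def vec_eq_iff)

lemma alg_part_stack [simp]: "alg_part (stack xd xa) = xa"
  by (simp add: alg_part_def stack_def vec_eq_iff)

lemma stack_0 [simp]: "stack 0 0 = 0"
  by (auto simp: stack_def vec_eq_iff split: sum.split)

lemma stack_parts: "stack (dyn_part x) (alg_part x) = x"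
  by (auto simp: dyn_part_def alg_part_def stack_def vec_eq_iff split: sum.split)

lemma mass_matrix_mult: "mass_matrix *v x = stack (dyn_part x) 0"
proof -
  have "(mass_matrix *v x) $ i = stack (dyn_part x) 0 $ i" for i
    unfolding matrix_vector_mult_def mass_matrix_def stack_def dyn_part_def
    by (cases i) (simp_all add: if_distrib[of "\<lambda>c. c * _"] cong: if_cong)
  then show ?thesis by (simp add: vec_eq_iff)
qed

lemma transpose_mass_matrix: "transpose mass_matrix = mass_matrix"
  by (auto simp: transpose_def mass_matrix_def vec_eq_iff)

lemma inner_stack: "stack a b \<bullet> x = a \<bullet> dyn_part x + b \<bullet> alg_part x"
  by (simp add: inner_vec_def UNIV_Plus_UNIV[symmetric] sum.Plus stack_def dyn_part_def
      alg_part_def del: UNIV_Plus_UNIV)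

lemma dae_rhs_has_derivative:
  assumes "(f has_derivative f') (at (xd, xa, w))" and "(g has_derivative g') (at (xd, xa))"
  shows "((\<lambda>x. dae_rhs f g x w) has_derivative
      (\<lambda>h. stack (f' (dyn_part h, alg_part h, 0)) (g' (dyn_part h, alg_part h))))
      (at (stack xd xa))"
proof -
  let ?x = "stack xd xa"
  note parts = bounded_linear.has_derivative[OF bounded_linear_dyn_part has_derivative_ident]
    bounded_linear.has_derivative[OF bounded_linear_alg_part has_derivative_ident]
  have "((\<lambda>x. (dyn_part x, alg_part x, w)) has_derivative
      (\<lambda>h. (dyn_part h, alg_part h, 0))) (at ?x)"
    by (intro has_derivative_Pair parts has_derivative_const)
  then have 1: "((\<lambda>x. f (dyn_part x, alg_part x, w)) has_derivative
      (\<lambda>h. f' (dyn_part h, alg_part h, 0))) (at ?x)"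
    by (rule has_derivative_compose) (simp add: assms)
  have "((\<lambda>x. (dyn_part x, alg_part x)) has_derivative
      (\<lambda>h. (dyn_part h, alg_part h))) (at ?x)"
    by (intro has_derivative_Pair parts)
  then have 2: "((\<lambda>x. g (dyn_part x, alg_part x)) has_derivative
      (\<lambda>h. g' (dyn_part h, alg_part h))) (at ?x)"
    by (rule has_derivative_compose) (simp add: assms)
  show ?thesis unfolding dae_rhs_def
    using bounded_linear.has_derivative[OF bounded_linear_stack has_derivative_Pair[OF 1 2]]
    by simp
qed

section \<open>From strangeness index zero to an invertible constraint Jacobian\<close>

text \<open>Strangeness index zero makes \<open>E\<close> injective on the kernel of
  \<open>Z\<^sup>T N\<close>. The assumption on \<open>N\<close> places \<open>y\<close> in that
  kernel.\<close>

lemma strangeness_free_kernel: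
  fixes F :: "real \<Rightarrow> real^'n \<Rightarrow> real^'n \<Rightarrow> real^'n"
  assumes F: "strangeness_free F" "F t x v = 0"
    and N: "\<And>z. transpose (Jacobian (\<lambda>w. F t x w) v) *v z = 0 \<Longrightarrow>
        z \<bullet> (Jacobian (\<lambda>y. F t y v) x *v y) = 0"
    and E: "Jacobian (\<lambda>w. F t x w) v *v y = 0"
  shows "y = 0"
proof -
  define E where "E = Jacobian (\<lambda>w. F t x w) v"
  define N where "N = Jacobian (\<lambda>y. F t y v) x"
  define coker where "coker = {z. transpose E *v z = 0}"
  define K where "K = {y. \<forall>z\<in>coker. z \<bullet> (N *v y) = 0}"
  obtain a d where ad: "a + d = CARD('n)" "dim ((\<lambda>z. transpose N *v z) ` coker) = a"
      "dim ((\<lambda>y. E *v y) ` K) = d"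
    using F unfolding strangeness_free_def Let_def E_def N_def coker_def K_def by blast
  have "subspace coker"
    by (auto simp: coker_def subspace_def matrix_vector_right_distrib matrix_vector_mult_scaleR
        simp del: transpose_matrix_vector)
  \<comment> \<open>Since \<open>a + d\<close> is the full dimension, the kernel has dimension
    \<open>d\<close>, which is also the dimension of its image under \<open>E\<close>.\<close>
  then have "dim K = d"
    using ad(1,2) dim_kernel_matrix[of coker N] by (simp add: K_def)
  moreover have "subspace K"
    by (auto simp: K_def subspace_def matrix_vector_right_distrib inner_add_right
        matrix_vector_mult_scaleR)
  ultimately have "inj_on (\<lambda>y. E *v y) K"
    using ad(3) by (intro linear_inj_on_dim_image) auto
  moreover have "y \<in> K" "0 \<in> K"
    using N \<open>subspace K\<close> by (auto simp: K_def coker_def E_def N_def subspace_0)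
  ultimately show "y = 0"
    using E by (auto simp: inj_on_def E_def)
qed

lemma strangeness_free_invertible_G_xa:
  fixes f :: "(real^'nd) \<times> (real^'na) \<times> (real^'nu) \<Rightarrow> real^'nd"
    and g :: "(real^'nd) \<times> (real^'na) \<Rightarrow> real^'na"
  assumes sf: "strangeness_free (dae_residual f g u)" and zero: "g (xd, xa) = 0"
    and f': "(f has_derivative f') (at (xd, xa, u t))"
    and g': "(g has_derivative g') (at (xd, xa))"
  shows "invertible (G_xa g xd xa)"
  unfolding invertible_iff_ker
proof (intro allI impI)
  fix k assume k: "G_xa g xd xa *v k = 0"
  let ?F = "dae_residual f g u" and ?x = "stack xd xa"
  \<comment> \<open>A velocity at which the residual vanishes: its dynamic part must be the value of
    \<open>f\<close>, while its algebraic part is annihilated by the mass matrix and can be taken to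
    be 0.\<close>
  let ?v = "stack (f (xd, xa, u t)) (0 :: real^'na)"
  let ?M = "mass_matrix :: real^('nd + 'na)^('nd + 'na)"
  have "((\<lambda>w. ?M *v w - dae_rhs f g ?x (u t)) has_derivative (\<lambda>w. ?M *v w - 0)) (at ?v)"
    by (intro has_derivative_diff has_derivative_const bounded_linear_imp_has_derivative
        matrix_vector_mul_bounded_linear)
  then have E: "Jacobian (\<lambda>w. ?F t ?x w) ?v *v y = ?M *v y" for y
    unfolding dae_residual_def by (subst Jacobian_mult) simp_all
  then have EM: "Jacobian (\<lambda>w. ?F t ?x w) ?v = ?M" by (simp add: matrix_eq)
  have "((\<lambda>y. ?M *v ?v - dae_rhs f g y (u t)) has_derivative
      (\<lambda>h. 0 - stack (f' (dyn_part h, alg_part h, 0)) (g' (dyn_part h, alg_part h)))) (at ?x)"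
    by (intro has_derivative_diff has_derivative_const dae_rhs_has_derivative f' g')
  then have N: "Jacobian (\<lambda>y. ?F t y ?v) ?x *v h =
      - stack (f' (dyn_part h, alg_part h, 0)) (g' (dyn_part h, alg_part h))" for h
    unfolding dae_residual_def by (subst Jacobian_mult) simp_all
  have "stack 0 k = (0 :: real^('nd + 'na))"
  proof (rule strangeness_free_kernel[OF sf])
    show "?F t ?x ?v = 0"
      using zero by (simp add: dae_residual_def mass_matrix_mult dae_rhs_def)
    show "Jacobian (\<lambda>w. ?F t ?x w) ?v *v stack 0 k = 0"
      unfolding E mass_matrix_mult by simp
    \<comment> \<open>The kernel of \<open>E\<^sup>T\<close> consists of the vectors without dynamic
      part. They see only the algebraic rows of \<open>N\<close>, which send \<open>(0, k)\<close>
      to \<open>- g' (0, k) = 0\<close>.\<close>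
    fix z assume "transpose (Jacobian (\<lambda>w. ?F t ?x w) ?v) *v z = 0"
    then have "stack (dyn_part z) 0 = (0 :: real^('nd + 'na))"
      by (simp add: EM transpose_mass_matrix mass_matrix_mult)
    then have "dyn_part z = 0"
      by (metis dyn_part_stack stack_0)
    moreover have "g' (0, k) = 0" using k G_xa_mult[OF g'] by simp
    ultimately show "z \<bullet> (Jacobian (\<lambda>y. ?F t y ?v) ?x *v stack 0 k) = 0"
      unfolding N using inner_stack[of "dyn_part z" "alg_part z", unfolded stack_parts] by simp
  qed
  then show "k = 0"
    by (metis alg_part_stack stack_0)
qed

section \<open>Equivalence of DAE and ODE solutions\<close>

text \<open>Differentiability of \<open>xa\<close> has to be produced. Near \<open>t\<close>,
  continuity keeps both parts of the solution in the box of the implicit function, where the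
  constraint forces \<open>xa\<close> to be \<open>\<phi>\<close> of \<open>xd\<close>, and the
  chain rule applies.\<close>

lemma dae_imp_ode_solution:
  fixes f :: "(real^'nd) \<times> (real^'na) \<times> (real^'nu) \<Rightarrow> real^'nd"
    and g :: "(real^'nd) \<times> (real^'na) \<Rightarrow> real^'na"
    and g' :: "(real^'nd) \<times> (real^'na) \<Rightarrow> ((real^'nd) \<times> (real^'na)) \<Rightarrow>\<^sub>L (real^'na)"
  assumes der: "\<And>p. (g has_derivative blinfun_apply (g' p)) (at p)"
    and cont: "continuous_on UNIV g'"
    and inv: "\<And>xd xa. g (xd, xa) = 0 \<Longrightarrow> invertible (G_xa g xd xa)"
    and sol: "dae_solution f g u J xd xa"
  shows "ode_solution f (g_tilde f g) u J xd xa"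
  unfolding ode_solution_def
proof (intro ballI conjI)
  fix t assume t: "t \<in> J"
  have d: "(xd has_vector_derivative f (xd t, xa t, u t)) (at t within J)"
    and zero: "\<And>s. s \<in> J \<Longrightarrow> g (xd s, xa s) = 0" and xa: "continuous_on J xa"
    using sol t unfolding dae_solution_def by auto
  then show "(xd has_vector_derivative f (xd t, xa t, u t)) (at t within J)" by simp
  have ker: "\<And>k. g' (xd t, xa t) (0, k) = 0 \<Longrightarrow> k = 0"
    using inv[OF zero[OF t]] G_xa_mult[OF der] by (metis invertible_iff_ker)
  obtain U V \<phi> \<phi>' where *: "open U" "open V" "xd t \<in> U" "xa t \<in> V" "\<phi> ` U \<subseteq> V"
      "\<forall>x\<in>U. \<forall>y\<in>V. g (x, y) = 0 \<longleftrightarrow> y = \<phi> x"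
      "\<forall>x\<in>U. (\<phi> has_derivative \<phi>' x) (at x)"
      "\<forall>x\<in>U. \<forall>h. g' (x, \<phi> x) (h, \<phi>' x h) = 0"
    by (rule implicit_function[OF der cont zero[OF t] ker])
  \<comment> \<open>The filter \<open>at t within J\<close> omits \<open>t\<close> itself, so the
    equality at \<open>t\<close> is recorded separately for the transfer of the derivative to
    \<open>xa\<close>.\<close>
  have eq: "\<phi> (xd t) = xa t" using * zero t by metis
  have "(xd \<longlongrightarrow> xd t) (at t within J)" "(xa \<longlongrightarrow> xa t) (at t within J)"
    using has_vector_derivative_continuous[OF d] xa t
    by (auto simp: continuous_within continuous_on_def)
  then have "\<forall>\<^sub>F s in at t within J. xd s \<in> U" "\<forall>\<^sub>F s in at t within J. xa s \<in> V"
    using * by (auto intro: topological_tendstoD)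
  moreover have "\<forall>\<^sub>F s in at t within J. s \<in> J"
    by (simp add: eventually_at_filter)
  ultimately have ev: "\<forall>\<^sub>F s in at t within J. \<phi> (xd s) = xa s"
    by eventually_elim (use * zero in metis)
  \<comment> \<open>\<open>\<phi>\<close> is differentiable in the full sense at
    \<open>xd t\<close>, so the composition has a derivative within \<open>J\<close>, one-sided at
    endpoints.\<close>
  have "((\<lambda>s. \<phi> (xd s)) has_derivative (\<lambda>h. \<phi>' (xd t) (h *\<^sub>R f (xd t, xa t, u t)))) (at t within J)"
    by (rule has_derivative_compose[OF d[unfolded has_vector_derivative_def] *(7)[rule_format, OF *(3)]])
  then have "((\<lambda>s. \<phi> (xd s)) has_vector_derivative \<phi>' (xd t) (f (xd t, xa t, u t))) (at t within J)"
    unfolding has_vector_derivative_def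
    using has_derivative_bounded_linear[OF *(7)[rule_format, OF *(3)]]
    by (simp add: bounded_linear.linear linear_scale)
  then have "(xa has_vector_derivative \<phi>' (xd t) (f (xd t, xa t, u t))) (at t within J)"
    unfolding has_vector_derivative_def
    by (rule has_derivative_transform_eventually[OF _ ev eq t])
  moreover have "\<phi>' (xd t) (f (xd t, xa t, u t)) = g_tilde f g (xd t, xa t, u t)"
    using *(8)[rule_format, OF *(3)] derivative_eq_0_iff[OF der inv[OF zero[OF t]]]
    unfolding g_tilde_def by (simp add: eq)
  ultimately show "(xa has_vector_derivative g_tilde f g (xd t, xa t, u t)) (at t within J)"
    by simp
qed

text \<open>
  Off the zero set of \<open>g\<close> the inverse in \<open>g_tilde\<close> may be a junk value, so \<open>g\<close> is known to be
  constant along an ODE trajectory only near the times at which it vanishes. This makes the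
  set of these times open as well as closed in the interval.
\<close>
lemma ode_imp_dae_solution:
  fixes f :: "(real^'nd) \<times> (real^'na) \<times> (real^'nu) \<Rightarrow> real^'nd"
    and g :: "(real^'nd) \<times> (real^'na) \<Rightarrow> real^'na"
    and g' :: "(real^'nd) \<times> (real^'na) \<Rightarrow> ((real^'nd) \<times> (real^'na)) \<Rightarrow>\<^sub>L (real^'na)"
  assumes der: "\<And>p. (g has_derivative blinfun_apply (g' p)) (at p)"
    and cont: "continuous_on UNIV g'"
    and inv: "\<And>xd xa. g (xd, xa) = 0 \<Longrightarrow> invertible (G_xa g xd xa)"
    and sol: "ode_solution f (g_tilde f g) u J xd xa"
    and J: "is_interval J" "t0 \<in> J" and init: "g (xd t0, xa t0) = 0"
  shows "dae_solution f g u J xd xa"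
proof -
  have dd: "(xd has_vector_derivative f (xd t, xa t, u t)) (at t within J)"
    and da: "(xa has_vector_derivative g_tilde f g (xd t, xa t, u t)) (at t within J)"
    if "t \<in> J" for t
    using sol that unfolding ode_solution_def by auto
  have contd: "continuous_on J xd" and conta: "continuous_on J xa"
    using has_vector_derivative_continuous[OF dd] has_vector_derivative_continuous[OF da]
    by (auto simp: continuous_on_eq_continuous_within)
  define \<gamma> where "\<gamma> = (\<lambda>t. g (xd t, xa t))"
  define S where "S = {t \<in> J. \<gamma> t = 0}"
  \<comment> \<open>At times in \<open>D\<close> the inverse in \<open>g_tilde\<close> is a genuine
    one. The zero times \<open>S\<close> lie in \<open>D\<close> by \<open>inv\<close>.\<close>
  define D where "D = {t \<in> J. det (G_xa g (xd t) (xa t)) \<noteq> 0}"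
  have contg: "continuous_on UNIV g"
    using der has_derivative_continuous by (blast intro: continuous_at_imp_continuous_on)
  have "continuous_on J (\<lambda>t. (xd t, xa t))" by (intro continuous_intros contd conta)
  then have cont\<gamma>: "continuous_on J \<gamma>"
    and contdet: "continuous_on J (\<lambda>t. det (G_xa g (xd t) (xa t)))"
    using continuous_on_compose2[OF contg] continuous_on_compose2[OF continuous_det_G_xa[OF der cont]]
    unfolding \<gamma>_def by fastforce+
  have \<gamma>': "(\<gamma> has_derivative (\<lambda>h. 0)) (at t within J)" if "t \<in> D" for t
  proof -
    let ?a = "f (xd t, xa t, u t)" and ?b = "g_tilde f g (xd t, xa t, u t)"
    have t: "t \<in> J" and inv': "invertible (G_xa g (xd t) (xa t))"
      using that by (auto simp: D_def invertible_det_nz)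
    \<comment> \<open>By the definition of \<open>g_tilde\<close>, \<open>?b\<close> is the
      algebraic velocity that balances the change of \<open>g\<close> caused by
      \<open>?a\<close>.\<close>
    have "g' (xd t, xa t) (?a, ?b) = 0"
      unfolding derivative_eq_0_iff[OF der inv'] by (simp add: g_tilde_def)
    then have "g' (xd t, xa t) (h *\<^sub>R ?a, h *\<^sub>R ?b) = 0" for h
      using blinfun.scaleR_right[of "g' (xd t, xa t)" h "(?a, ?b)"] by simp
    moreover have "((\<lambda>s. (xd s, xa s)) has_derivative (\<lambda>h. (h *\<^sub>R ?a, h *\<^sub>R ?b))) (at t within J)"
      using dd[OF t] da[OF t] unfolding has_vector_derivative_def by (rule has_derivative_Pair)
    from has_derivative_compose[OF this der]
    have "(\<gamma> has_derivative (\<lambda>h. g' (xd t, xa t) (h *\<^sub>R ?a, h *\<^sub>R ?b))) (at t within J)"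
      unfolding \<gamma>_def .
    ultimately show ?thesis by simp
  qed
  have "openin (top_of_set J) S"
    unfolding openin_contains_ball
  proof (intro conjI ballI)
    show "S \<subseteq> J" by (auto simp: S_def)
    fix t assume t: "t \<in> S"
    have "openin (top_of_set J) (J \<inter> (\<lambda>t. det (G_xa g (xd t) (xa t))) -` (- {0}))"
      using contdet by (rule continuous_openin_preimage_gen) (simp add: open_Compl)
    moreover have "J \<inter> (\<lambda>t. det (G_xa g (xd t) (xa t))) -` (- {0}) = D"
      by (auto simp: D_def)
    ultimately have "openin (top_of_set J) D" by simp
    moreover have "t \<in> D"
      using t inv by (auto simp: S_def D_def \<gamma>_def invertible_det_nz)
    ultimately obtain e where e: "e > 0" "ball t e \<inter> J \<subseteq> D"
      unfolding openin_contains_ball by blast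
    have "ball t e \<inter> J \<subseteq> S"
    proof
      fix s assume s: "s \<in> ball t e \<inter> J"
      \<comment> \<open>Convexity turns the vanishing derivative into constancy of
        \<open>\<gamma>\<close> near \<open>t\<close>, also when \<open>t\<close> is an endpoint of
        \<open>J\<close>.\<close>
      have "convex (ball t e \<inter> J)"
        using J(1) by (intro convex_Int convex_ball) (simp add: is_interval_convex)
      moreover have "(\<gamma> has_derivative (\<lambda>h. 0)) (at r within ball t e \<inter> J)"
        if "r \<in> ball t e \<inter> J" for r
        using \<gamma>' e(2) that by (blast intro: has_derivative_subset)
      moreover have "t \<in> ball t e \<inter> J" using t e(1) by (simp add: S_def)
      ultimately have "\<gamma> t = \<gamma> s"
        using s has_derivative_zero_constant[of "ball t e \<inter> J" \<gamma>] by metis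
      then show "s \<in> S" using s t by (simp add: S_def)
    qed
    then show "\<exists>e>0. ball t e \<inter> J \<subseteq> S" using e(1) by blast
  qed
  moreover have "closedin (top_of_set J) S"
    using continuous_closedin_preimage_constant[OF cont\<gamma>, of 0] by (simp add: S_def)
  moreover have "S \<noteq> {}" using J(2) init by (auto simp: S_def \<gamma>_def)
  ultimately have "S = J"
    using J(1) connected_clopen is_interval_connected by blast
  then show ?thesis
    unfolding dae_solution_def using conta dd by (auto simp: S_def \<gamma>_def)
qed

text \<open>The constraint at \<open>t0\<close> selects the ODE trajectories on the zero set of
  \<open>g\<close>; the constraint then propagates from this single time to all of
  \<open>J\<close>.\<close>

theorem proposition1:
  fixes f :: "(real^'nd) \<times> (real^'na) \<times> (real^'nu) \<Rightarrow> real^'nd"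
    and g :: "(real^'nd) \<times> (real^'na) \<Rightarrow> real^'na"
  assumes "continuously_differentiable f"
    and "continuously_differentiable g"
    and "assumption_S f g"
  shows "(\<forall>xd xa. g (xd, xa) = 0 \<longrightarrow> invertible (G_xa g xd xa)) \<and>
    (\<forall>xd0 xa0. g (xd0, xa0) = 0 \<longrightarrow>
      (\<exists>U V \<phi>. open U \<and> open V \<and> xd0 \<in> U \<and> xa0 \<in> V \<and> \<phi> ` U \<subseteq> V \<and>
         (\<forall>xd\<in>U. \<forall>xa\<in>V. g (xd, xa) = 0 \<longleftrightarrow> xa = \<phi> xd) \<and>
         (\<forall>xd\<in>U. (\<phi> has_derivative
            (\<lambda>h. - (matrix_inv (G_xa g xd (\<phi> xd)) *v (G_xd g xd (\<phi> xd) *v h)))) (at xd)))) \<and>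
    (\<forall>u J t0 xd xa. is_interval J \<longrightarrow> t0 \<in> J \<longrightarrow>
      (dae_solution f g u J xd xa \<longleftrightarrow>
       ode_solution f (g_tilde f g) u J xd xa \<and> g (xd t0, xa t0) = 0))"
proof -
  obtain f' :: "_ \<Rightarrow> _ \<Rightarrow>\<^sub>L (real^'nd)" where f': "\<And>p. (f has_derivative blinfun_apply (f' p)) (at p)"
    using assms(1) unfolding continuously_differentiable_def by blast
  obtain g' :: "_ \<Rightarrow> _ \<Rightarrow>\<^sub>L (real^'na)" where g': "\<And>p. (g has_derivative blinfun_apply (g' p)) (at p)"
    and cont: "continuous_on UNIV g'"
    using assms(2) unfolding continuously_differentiable_def by blast
  \<comment> \<open>The zero input serves as an admissible instance. Neither \<open>g\<close> nor
    \<open>G_xa\<close> involves the input, so the invertibility derived from it is available for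
    every \<open>u\<close>.\<close>
  have "continuously_differentiable (\<lambda>t::real. 0 :: real^'nu)"
    unfolding continuously_differentiable_def
    by (intro exI[of _ "\<lambda>t. 0"]) (simp add: zero_blinfun.rep_eq)
  then have sf: "strangeness_free (dae_residual f g (\<lambda>t. 0))"
    using assms(3) unfolding assumption_S_def by blast
  have inv: "invertible (G_xa g xd xa)" if "g (xd, xa) = 0" for xd xa
    using strangeness_free_invertible_G_xa[OF sf that f' g'] .
  have "\<exists>U V \<phi>. open U \<and> open V \<and> xd0 \<in> U \<and> xa0 \<in> V \<and> \<phi> ` U \<subseteq> V \<and>
         (\<forall>xd\<in>U. \<forall>xa\<in>V. g (xd, xa) = 0 \<longleftrightarrow> xa = \<phi> xd) \<and>
         (\<forall>xd\<in>U. (\<phi> has_derivative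
            (\<lambda>h. - (matrix_inv (G_xa g xd (\<phi> xd)) *v (G_xd g xd (\<phi> xd) *v h)))) (at xd))"
    if zero: "g (xd0, xa0) = 0" for xd0 xa0
  proof -
    have ker: "\<And>k. g' (xd0, xa0) (0, k) = 0 \<Longrightarrow> k = 0"
      using inv[OF zero] G_xa_mult[OF g'] by (metis invertible_iff_ker)
    obtain U V \<phi> \<phi>' where *: "open U" "open V" "xd0 \<in> U" "xa0 \<in> V" "\<phi> ` U \<subseteq> V"
        "\<forall>x\<in>U. \<forall>y\<in>V. g (x, y) = 0 \<longleftrightarrow> y = \<phi> x"
        "\<forall>x\<in>U. (\<phi> has_derivative \<phi>' x) (at x)"
        "\<forall>x\<in>U. \<forall>h. g' (x, \<phi> x) (h, \<phi>' x h) = 0"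
      by (rule implicit_function[OF g' cont zero ker])
    have "(\<phi> has_derivative
            (\<lambda>h. - (matrix_inv (G_xa g xd (\<phi> xd)) *v (G_xd g xd (\<phi> xd) *v h)))) (at xd)"
      if xd: "xd \<in> U" for xd
    proof -
      \<comment> \<open>The value \<open>\<phi> xd\<close> lies in \<open>V\<close>, so the
        equivalence applies to it; this makes \<open>G_xa\<close> invertible along the whole graph
        and not only at the base point.\<close>
      have "g (xd, \<phi> xd) = 0" using * xd by blast
      then have "\<phi>' xd = (\<lambda>h. - (matrix_inv (G_xa g xd (\<phi> xd)) *v (G_xd g xd (\<phi> xd) *v h)))"
        using *(8)[rule_format, OF xd] derivative_eq_0_iff[OF g' inv] by blast
      then show ?thesis using *(7)[rule_format, OF xd] by simp
    qed
    then show ?thesis using *(1-6) by blast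
  qed
  moreover have "dae_solution f g u J xd xa \<longleftrightarrow>
       ode_solution f (g_tilde f g) u J xd xa \<and> g (xd t0, xa t0) = 0"
    if "is_interval J" "t0 \<in> J" for u J t0 xd xa
  proof
    assume sol: "dae_solution f g u J xd xa"
    then show "ode_solution f (g_tilde f g) u J xd xa \<and> g (xd t0, xa t0) = 0"
      using dae_imp_ode_solution[OF g' cont inv sol] that(2) by (simp add: dae_solution_def)
  next
    assume "ode_solution f (g_tilde f g) u J xd xa \<and> g (xd t0, xa t0) = 0"
    then show "dae_solution f g u J xd xa"
      using ode_imp_dae_solution[OF g' cont inv] that by blast
  qed
  ultimately show ?thesis using inv by blast
qed

end
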